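(* The axiom system $\Sigma = \{A3, B1, B2, B3, B4, B5, B6, B7\}$ described in the context is completely independent: for every subset $A \subseteq \Sigma$, the set of sentences $A \cup \{\neg\varphi : \varphi \in \Sigma \setminus A\}$ is satisfiable.
   Context: Work in classical one-sorted first-order logic with equality, in the language with three constant symbols $a_0, a_1, a_2$, a ternary relation symbol $L$ (collinearity) and a ternary function symbol $\tau$. Write $\sigma(a,b)$ as an abbreviation for $\tau(b,a,a)$. The axioms below are understood as universally closed sentences: A3: $a \ne b \wedge L(a,b,c) \wedge L(a,b,d) \rightarrow L(a,c,d)$; B1: $L(a,b,c) \rightarrow L(b,a,c)$; B2: $\tau(a,b,c) = \tau(a,c,b)$; B3: $L(a,b,\sigma(a,b))$; B4: $L(a,b,c) \rightarrow L(x, \tau(a,b,x), \tau(a,c,x))$; B5: $\tau(a,b,x) = x \rightarrow a = b$; B6: $\tau(a,b,x) = \tau(c, \tau(a,b,x), x)$; B7: $\neg L(a_0,a_1,a_2)$. $\Sigma$ is the set $\{A3,B1,B2,B3,B4,B5,B6,B7\}$.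
   Formalization: Axiom B6 is corrected to τ(a,b,x) = τ(c, τ(a,b,c), x); as printed, with τ(a,b,x) as the inner term, B6 with B2 and B5 forces a one-point domain, so by B3 and B7 the full system Σ would be unsatisfiable. *)

theory Defs
  imports Main
begin

section \<open>First-order logic over the signature \<open>a\<^sub>0\<close>, \<open>a\<^sub>1\<close>, \<open>a\<^sub>2\<close>, \<open>L\<close>, \<open>\<tau>\<close>\<close>

datatype tm = Var nat | A0 | A1 | A2 | Tau tm tm tm

datatype fm = Eq tm tm | Coll tm tm tm | Neg fm | Conj fm fm | Imp fm fm | All nat fm

record 'u struct =
  dom :: "'u set"
  c0 :: 'u
  c1 :: 'u
  c2 :: 'u
  coll :: "'u \<Rightarrow> 'u \<Rightarrow> 'u \<Rightarrow> bool"
  trl :: "'u \<Rightarrow> 'u \<Rightarrow> 'u \<Rightarrow> 'u"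

definition is_struct :: "'u struct \<Rightarrow> bool" where
  "is_struct M \<longleftrightarrow> dom M \<noteq> {} \<and> c0 M \<in> dom M \<and> c1 M \<in> dom M \<and> c2 M \<in> dom M \<and>
     (\<forall>x\<in>dom M. \<forall>y\<in>dom M. \<forall>z\<in>dom M. trl M x y z \<in> dom M)"

fun val :: "'u struct \<Rightarrow> (nat \<Rightarrow> 'u) \<Rightarrow> tm \<Rightarrow> 'u" where
  "val M v (Var n) = v n"
| "val M v A0 = c0 M"
| "val M v A1 = c1 M"
| "val M v A2 = c2 M"
| "val M v (Tau s t u) = trl M (val M v s) (val M v t) (val M v u)"

fun sat :: "'u struct \<Rightarrow> (nat \<Rightarrow> 'u) \<Rightarrow> fm \<Rightarrow> bool" where
  "sat M v (Eq s t) \<longleftrightarrow> val M v s = val M v t"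
| "sat M v (Coll s t u) \<longleftrightarrow> coll M (val M v s) (val M v t) (val M v u)"
| "sat M v (Neg p) \<longleftrightarrow> \<not> sat M v p"
| "sat M v (Conj p q) \<longleftrightarrow> sat M v p \<and> sat M v q"
| "sat M v (Imp p q) \<longleftrightarrow> (sat M v p \<longrightarrow> sat M v q)"
| "sat M v (All n p) \<longleftrightarrow> (\<forall>x\<in>dom M. sat M (v(n := x)) p)"

definition models :: "'u struct \<Rightarrow> fm set \<Rightarrow> bool" where
  "models M T \<longleftrightarrow> (\<forall>p\<in>T. \<forall>v. range v \<subseteq> dom M \<longrightarrow> sat M v p)"

text \<open>
  HOL cannot quantify existentially over types, so the type of elements must be fixed. Domains are
  arbitrary nonempty subsets of \<^typ>\<open>nat\<close>: since the language is countable, the downward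
  Loewenheim-Skolem theorem shows that a set of sentences that has any model has one of this form.
\<close>

definition satisfiable :: "fm set \<Rightarrow> bool" where
  "satisfiable T \<longleftrightarrow> (\<exists>M :: nat struct. is_struct M \<and> models M T)"


section \<open>The axioms\<close>

text \<open>\<^term>\<open>closure n p\<close> is the universal closure of a formula \<^term>\<open>p\<close> whose free variables are
  among \<open>Var 0, \<dots>, Var (n - 1)\<close>.\<close>

definition closure :: "nat \<Rightarrow> fm \<Rightarrow> fm" where
  "closure n p = foldr All [0..<n] p"

abbreviation sigma :: "tm \<Rightarrow> tm \<Rightarrow> tm" where
  "sigma a b \<equiv> Tau b a a"

definition A3 :: fm where
  "A3 = (let a = Var 0; b = Var 1; c = Var 2; d = Var 3 in
     closure 4 (Imp (Conj (Neg (Eq a b)) (Conj (Coll a b c) (Coll a b d))) (Coll a c d)))"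

definition B1 :: fm where
  "B1 = (let a = Var 0; b = Var 1; c = Var 2 in
     closure 3 (Imp (Coll a b c) (Coll b a c)))"

definition B2 :: fm where
  "B2 = (let a = Var 0; b = Var 1; c = Var 2 in
     closure 3 (Eq (Tau a b c) (Tau a c b)))"

definition B3 :: fm where
  "B3 = (let a = Var 0; b = Var 1 in
     closure 2 (Coll a b (sigma a b)))"

definition B4 :: fm where
  "B4 = (let a = Var 0; b = Var 1; c = Var 2; x = Var 3 in
     closure 4 (Imp (Coll a b c) (Coll x (Tau a b x) (Tau a c x))))"

definition B5 :: fm where
  "B5 = (let a = Var 0; b = Var 1; x = Var 2 in
     closure 3 (Imp (Eq (Tau a b x) x) (Eq a b)))"

text \<open>
  The translation taking \<open>a\<close> to \<open>b\<close> is also the one taking \<open>c\<close> to \<open>\<tau>(a,b,c)\<close>. The form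
  \<open>\<tau>(a,b,x) = \<tau>(c, \<tau>(a,b,x), x)\<close>, with \<open>x\<close> for \<open>c\<close> in the inner term, is a misprint: together
  with B2 and B5 it forces the domain to have a single element, so together with B2, B3, B5 and B7
  it has no model.
\<close>

definition B6 :: fm where
  "B6 = (let a = Var 0; b = Var 1; c = Var 2; x = Var 3 in
     closure 4 (Eq (Tau a b x) (Tau c (Tau a b c) x)))"

definition B7 :: fm where
  "B7 = Neg (Coll A0 A1 A2)"

definition Sigma_ax :: "fm set" where
  "Sigma_ax = {A3, B1, B2, B3, B4, B5, B6, B7}"

end

theory Submission
  imports Defs
begin

text \<open>
  Every model has the four points \<open>0, 1, 2, 3\<close>. Only \<open>B7\<close> mentions the constants, so if \<open>L\<close> is
  neither empty nor full, a suitable choice of the constants makes \<open>B7\<close> true or false at will. The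
  axioms \<open>B2\<close>, \<open>B5\<close>, \<open>B6\<close> speak only of \<open>\<tau>\<close>, and \<open>A3\<close>, \<open>B1\<close> only of \<open>L\<close>. Hence it
  suffices to fix one \<open>\<tau>\<close> for each of the eight truth patterns of \<open>B2\<close>, \<open>B5\<close>, \<open>B6\<close>, and
  for each truth pattern of \<open>A3\<close>, \<open>B1\<close> a short list of relations which, for each of the eight
  \<open>\<tau>\<close>, realises all four truth patterns of \<open>B3\<close>, \<open>B4\<close>.
\<close>

lemma sat_A3: "sat M v A3 \<longleftrightarrow>
    (\<forall>a\<in>dom M. \<forall>b\<in>dom M. \<forall>c\<in>dom M. \<forall>d\<in>dom M.
      a \<noteq> b \<and> coll M a b c \<and> coll M a b d \<longrightarrow> coll M a c d)"
  by (simp add: A3_def closure_def Let_def upt_rec)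

lemma sat_B1: "sat M v B1 \<longleftrightarrow>
    (\<forall>a\<in>dom M. \<forall>b\<in>dom M. \<forall>c\<in>dom M. coll M a b c \<longrightarrow> coll M b a c)"
  by (simp add: B1_def closure_def Let_def upt_rec)

lemma sat_B2: "sat M v B2 \<longleftrightarrow>
    (\<forall>a\<in>dom M. \<forall>b\<in>dom M. \<forall>c\<in>dom M. trl M a b c = trl M a c b)"
  by (simp add: B2_def closure_def Let_def upt_rec)

lemma sat_B3: "sat M v B3 \<longleftrightarrow>
    (\<forall>a\<in>dom M. \<forall>b\<in>dom M. coll M a b (trl M b a a))"
  by (simp add: B3_def closure_def Let_def upt_rec)

lemma sat_B4: "sat M v B4 \<longleftrightarrow>
    (\<forall>a\<in>dom M. \<forall>b\<in>dom M. \<forall>c\<in>dom M. \<forall>x\<in>dom M.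
      coll M a b c \<longrightarrow> coll M x (trl M a b x) (trl M a c x))"
  by (simp add: B4_def closure_def Let_def upt_rec)

lemma sat_B5: "sat M v B5 \<longleftrightarrow>
    (\<forall>a\<in>dom M. \<forall>b\<in>dom M. \<forall>x\<in>dom M. trl M a b x = x \<longrightarrow> a = b)"
  by (simp add: B5_def closure_def Let_def upt_rec)

lemma sat_B6: "sat M v B6 \<longleftrightarrow>
    (\<forall>a\<in>dom M. \<forall>b\<in>dom M. \<forall>c\<in>dom M. \<forall>x\<in>dom M.
      trl M a b x = trl M c (trl M a b c) x)"
  by (simp add: B6_def closure_def Let_def upt_rec)

lemma sat_B7: "sat M v B7 \<longleftrightarrow> \<not> coll M (c0 M) (c1 M) (c2 M)"
  by (simp add: B7_def)

lemmas sat_axioms = sat_A3 sat_B1 sat_B2 sat_B3 sat_B4 sat_B5 sat_B6 sat_B7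

text \<open>Truth does not depend on the valuation, so an axiom outside \<open>A\<close> fails under
  every \<open>v\<close> and its negation is valid in \<open>M\<close>.\<close>

lemma satisfiable_if_truth_pattern:
  fixes M :: "nat struct"
  assumes "is_struct M"
    and "\<And>p v. p \<in> Sigma_ax \<Longrightarrow> sat M v p \<longleftrightarrow> p \<in> A"
    and "A \<subseteq> Sigma_ax"
  shows "satisfiable (A \<union> {Neg p | p. p \<in> Sigma_ax - A})"
  using assms unfolding satisfiable_def models_def by (intro exI[of _ M]) auto

definition pts :: "nat list" where
  "pts = [0, 1, 2, 3]"

text \<open>Addition in the Klein four-group: the three elements other than \<open>0\<close> add up to \<open>6\<close> as
  numbers, and any two of them add up to the third in the group.\<close>

definition klein :: "nat \<Rightarrow> nat \<Rightarrow> nat" where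
  "klein a b = (if a = b then 0 else if a = 0 then b else if b = 0 then a else 6 - (a + b))"

text \<open>The minimal excludant: it is symmetric, and \<open>mex b x\<close> never equals
  \<open>x\<close>, so B5 holds vacuously.\<close>

definition mex :: "nat \<Rightarrow> nat \<Rightarrow> nat" where
  "mex a b = (if a \<noteq> 0 \<and> b \<noteq> 0 then 0 else if a \<noteq> 1 \<and> b \<noteq> 1 then 1 else 2)"

text \<open>If \<open>f\<close> and \<open>g\<close> agree nowhere, then \<open>B6\<close> holds for this \<open>\<tau>\<close>: the value at \<open>c\<close> reveals
  which of \<open>f\<close> and \<open>g\<close> was chosen.\<close>

definition switch :: "(nat \<Rightarrow> nat) \<Rightarrow> (nat \<Rightarrow> nat) \<Rightarrow> nat \<Rightarrow> nat \<Rightarrow> nat \<Rightarrow> nat" where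
  "switch f g a b x = (if b = f a then f x else g x)"

text \<open>The arguments are the truth values of \<open>B2\<close>, \<open>B5\<close>, \<open>B6\<close>. The first \<open>\<tau>\<close> is
  \<open>b + x - a\<close> in the Klein four-group, the third is \<open>b + x - a\<close> modulo 3.\<close>

fun tau :: "bool \<Rightarrow> bool \<Rightarrow> bool \<Rightarrow> nat \<Rightarrow> nat \<Rightarrow> nat \<Rightarrow> nat" where
  "tau True True True a b x = klein a (klein b x)"
| "tau True True False a b x = mex b x"
| "tau True False True a b x = (b + x + 2 * a) mod 3"
| "tau True False False a b x = min a (min b x)"
| "tau False True True a b x =
    switch (\<lambda>x. if x = 0 then 1 else 0) (\<lambda>x. if x < 2 then 2 else 1) a b x"
| "tau False True False a b x = (if a = x then klein x 1 else klein a (klein b x))"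
| "tau False False True a b x = switch (\<lambda>x. min x 1) (\<lambda>x. 2) a b x"
| "tau False False False a b x = klein x a"

text \<open>The arguments are the truth values of \<open>A3\<close> and \<open>B1\<close>. Row \<open>a\<close>, column \<open>b\<close> of each table
  lists the points \<open>c\<close> with \<open>L(a, b, c)\<close>. The tables were found by a SAT solver.\<close>

fun relations :: "bool \<Rightarrow> bool \<Rightarrow> nat list list list list" where
  "relations True True =
     [[[[0,1,2,3],[0,1,2],[0,1,2],[0,1,2]],[[0,1,2],[0,1,2,3],[0,1,2],[0,1,2]],[[0,1,2],[0,1,2],[0,1,2,3],[0,1,2]],[[0,1,2],[0,1,2],[0,1,2],[0,1,2,3]]],
      [[[0,1,2,3],[0,1],[0,2],[0,3]],[[0,1],[0,1,2,3],[1,2,3],[1,2,3]],[[0,2],[1,2,3],[0,1,2,3],[1,2,3]],[[0,3],[1,2,3],[1,2,3],[0,1,2,3]]],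
      [[[0,1,2,3],[0,1,3],[0,1],[0,1,3]],[[0,1,3],[0,1,2,3],[0,1],[0,1,3]],[[0,1],[0,1],[0,1,2,3],[0]],[[0,1,3],[0,1,3],[0],[0,1,2,3]]],
      [[[0,1,2,3],[0,1],[0,2],[]],[[0,1],[0,1,2,3],[],[1,3]],[[0,2],[],[0,1,2,3],[2,3]],[[],[1,3],[2,3],[0,1,2,3]]],
      [[[0,1,2,3],[0,1,2],[0,1,2],[0,3]],[[0,1,2],[0,1,2,3],[0,1,2],[1,2]],[[0,1,2],[0,1,2],[0,1,2,3],[1,2]],[[0,3],[1,2],[1,2],[0,1,2,3]]],
      [[[0,1,2],[0,1,2],[0,1,2],[0,1,2]],[[0,1,2],[0,1,2],[0,1,2],[0,1,2]],[[0,1,2],[0,1,2],[0,1,2],[0,1,2]],[[0,1,2],[0,1,2],[0,1,2],[]]],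
      [[[0,1,2,3],[1,2,3],[1,2,3],[1,2,3]],[[1,2,3],[0,1,2,3],[1,2,3],[1,2,3]],[[1,2,3],[1,2,3],[0,1,2,3],[1,2,3]],[[1,2,3],[1,2,3],[1,2,3],[0,1,2,3]]],
      [[[0,1,2,3],[0,1,2],[0,1,2],[1,2]],[[0,1,2],[0,1,2,3],[0,1,2],[1,2]],[[0,1,2],[0,1,2],[0,1,2,3],[1,2]],[[1,2],[1,2],[1,2],[1,2,3]]],
      [[[0,1,2,3],[0,1],[0,2],[0,3]],[[0,1],[0,1,2,3],[1,2],[1,3]],[[0,2],[1,2],[0,1,2,3],[2,3]],[[0,3],[1,3],[2,3],[0,1,2,3]]]]"
| "relations True False =
     [[[[1,2,3],[1,3],[1,3],[1,3]],[[0,2,3],[0,2,3],[0,2,3],[0,2,3]],[[0,1,3],[0,1,3],[0,1,3],[0,1,3]],[[0,1,2],[0,1,2],[0,1,2],[0,1,2]]],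
      [[[0,1,2,3],[0,1,2],[0,1,2],[0,3]],[[0,1,2,3],[0,1,2,3],[0,1,2,3],[0,1,2,3]],[[0,1,2,3],[0,1,2,3],[0,1,2,3],[0,1,2,3]],[[0,3],[1,2,3],[1,2,3],[0,1,2,3]]],
      [[[0,1,2,3],[1,2,3],[1,2,3],[1,2,3]],[[1,2,3],[0,1,2,3],[1,2,3],[1,2,3]],[[1,2,3],[1,2,3],[0,1,2,3],[1,2,3]],[[0,1,2,3],[0,1,2,3],[0,1,2,3],[0,1,2,3]]],
      [[[1,2,3],[1,2,3],[1,2,3],[1,2,3]],[[0,2,3],[0,2,3],[0,2,3],[0,2,3]],[[0,1,3],[0,1,3],[0,1,3],[0,1,3]],[[0,1,2],[0,1,2],[0,1,2],[0,1,2]]],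
      [[[0,1,2,3],[0,1,2,3],[0,1,2,3],[0,1,2,3]],[[0,1,2,3],[0,1,2,3],[0,1,2,3],[0,1,2,3]],[[0,1,2,3],[0,1,2,3],[0,1,2,3],[0,1,2,3]],[[0,1,2],[0,1,2],[0,1,2],[0,1,2,3]]],
      [[[0],[1],[2],[3]],[[0],[1],[2],[3]],[[0],[1],[2],[3]],[[0],[1],[2],[3]]]]"
| "relations False True =
     [[[[1,2,3],[0,1,2,3],[0,2],[0,1,2,3]],[[0,1,2,3],[0,2,3],[0,1,2,3],[1,3]],[[0,2],[0,1,2,3],[0,1,3],[0,1,2,3]],[[0,1,2,3],[1,3],[0,1,2,3],[0,1,2]]],
      [[[0,2,3],[0,1,2,3],[0,1,2,3],[0,1,2,3]],[[0,1,2,3],[1,2,3],[0,1,2,3],[0,1,2,3]],[[0,1,2,3],[0,1,2,3],[0,1,2],[0,1,2,3]],[[0,1,2,3],[0,1,2,3],[0,1,2,3],[0,1,3]]],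
      [[[0,1,2,3],[0,1,3],[0,1,2,3],[0,1,2,3]],[[0,1,3],[0,1,2,3],[0,1,2,3],[0,1,2,3]],[[0,1,2,3],[0,1,2,3],[0,1,2,3],[0,1,2,3]],[[0,1,2,3],[0,1,2,3],[0,1,2,3],[0,1,2]]],
      [[[0,1,2,3],[0,1,2,3],[0,1,2,3],[0,1,2,3]],[[0,1,2,3],[0,1,2,3],[0,1,2,3],[0,1,2,3]],[[0,1,2,3],[0,1,2,3],[0,1,2,3],[0,1,2,3]],[[0,1,2,3],[0,1,2,3],[0,1,2,3],[0,2,3]]],
      [[[0,2,3],[0,1,2,3],[0,1,2,3],[0,2,3]],[[0,1,2,3],[0,1,3],[0,1,2,3],[0,1,2,3]],[[0,1,2,3],[0,1,2,3],[1,2],[0,1,2,3]],[[0,2,3],[0,1,2,3],[0,1,2,3],[2]]]]"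
| "relations False False =
     [[[[],[1,2,3],[1,2,3],[0,1,2,3]],[[0,2,3],[],[0,1,2,3],[0,2,3]],[[0,1,3],[0,1,2,3],[],[0,1,3]],[[0,1,2,3],[0,1,2],[0,1,2],[]]],
      [[[0,1,2],[1,2],[1,2],[1,3]],[[0,2],[0,1,2],[0,2],[2,3]],[[0,1],[0,1],[0,1,2],[1,3]],[[0,1,2],[1,2],[1,2],[1,3]]],
      [[[0,1,2],[1,2],[0,1,2],[0,1,2,3]],[[0,1,2],[0,1,2],[0,1,3],[0,1,2]],[[0,1,2],[0,1,2,3],[0,1,2],[0,1,2]],[[0,1,2,3],[0,1,2],[0,1,2],[0,1,2,3]]],
      [[[0,1,2,3],[0,1,2,3],[0,1,2],[0,1,2,3]],[[0,1,2,3],[0,1,2,3],[0,1,2,3],[0,1,2,3]],[[0,1,2,3],[0,1,2,3],[0,1,2,3],[0,1,2,3]],[[0,1,2,3],[0,1,2,3],[0,1,2,3],[0,1,2,3]]],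
      [[[0,1,2,3],[0,1,2,3],[0,1,2,3],[0,1,3]],[[0,1,2,3],[0,1,2,3],[0,1,2],[0,1,2,3]],[[0,1,2,3],[1,2,3],[0,1,2,3],[0,1,2,3]],[[0,2,3],[0,1,2,3],[0,1,2,3],[0,1,2,3]]]]"

definition rel :: "nat list list list \<Rightarrow> nat \<Rightarrow> nat \<Rightarrow> nat \<Rightarrow> bool" where
  "rel R a b c = List.member (R ! a ! b) c"

definition model :: "nat list list list \<Rightarrow> (nat \<Rightarrow> nat \<Rightarrow> nat \<Rightarrow> nat) \<Rightarrow> nat \<Rightarrow> nat \<Rightarrow> nat \<Rightarrow> nat struct"
  where "model R t p q r = \<lparr>dom = set pts, c0 = p, c1 = q, c2 = r, coll = rel R, trl = t\<rparr>"

lemma tau_closed: "\<forall>p q r. \<forall>a\<in>set pts. \<forall>b\<in>set pts. \<forall>x\<in>set pts. tau p q r a b x \<in> set pts"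
  by code_simp

lemma tau_B2: "\<forall>p q r.
    (\<forall>a\<in>set pts. \<forall>b\<in>set pts. \<forall>c\<in>set pts. tau p q r a b c = tau p q r a c b) \<longleftrightarrow> p"
  by code_simp

text \<open>Addition modulo 3 violates B5 because it does not separate \<open>0\<close> from
  \<open>3\<close>.\<close>

lemma tau_B5: "\<forall>p q r.
    (\<forall>a\<in>set pts. \<forall>b\<in>set pts. \<forall>x\<in>set pts. tau p q r a b x = x \<longrightarrow> a = b) \<longleftrightarrow> q"
  by code_simp

lemma tau_B6: "\<forall>p q r.
    (\<forall>a\<in>set pts. \<forall>b\<in>set pts. \<forall>c\<in>set pts. \<forall>x\<in>set pts.
      tau p q r a b x = tau p q r c (tau p q r a b c) x) \<longleftrightarrow> r"
  by code_simp

lemma relations_A3: "\<forall>p q. \<forall>R\<in>set (relations p q).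
    (\<forall>a\<in>set pts. \<forall>b\<in>set pts. \<forall>c\<in>set pts. \<forall>d\<in>set pts.
      a \<noteq> b \<and> rel R a b c \<and> rel R a b d \<longrightarrow> rel R a c d) \<longleftrightarrow> p"
  by code_simp

lemma relations_B1: "\<forall>p q. \<forall>R\<in>set (relations p q).
    (\<forall>a\<in>set pts. \<forall>b\<in>set pts. \<forall>c\<in>set pts. rel R a b c \<longrightarrow> rel R b a c) \<longleftrightarrow> q"
  by code_simp

lemma relations_B7: "\<forall>p q. \<forall>R\<in>set (relations p q). \<forall>s.
    \<exists>a\<in>set pts. \<exists>b\<in>set pts. \<exists>c\<in>set pts. (\<not> rel R a b c) \<longleftrightarrow> s"
  by code_simp

text \<open>Pairing the truth values lets one inclusion in an image express that all four patterns
  occur.\<close>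

definition truth_B3_B4 :: "(nat \<Rightarrow> nat \<Rightarrow> nat \<Rightarrow> nat) \<Rightarrow> nat list list list \<Rightarrow> bool \<times> bool" where
  "truth_B3_B4 t R =
    ((\<forall>a\<in>set pts. \<forall>b\<in>set pts. rel R a b (t b a a)),
     (\<forall>a\<in>set pts. \<forall>b\<in>set pts. \<forall>c\<in>set pts. \<forall>x\<in>set pts.
       rel R a b c \<longrightarrow> rel R x (t a b x) (t a c x)))"

text \<open>The inductions merely instantiate the truth values: under a quantifier over them,
  \<open>code_simp\<close> would evaluate the body symbolically.\<close>

lemma relations_truth_B3_B4:
  "{(True, True), (True, False), (False, True), (False, False)} \<subseteq>
    truth_B3_B4 (tau p' q' r') ` set (relations p q)"
  by (induction p'; induction q'; induction r'; induction p; induction q; code_simp)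

lemma relations_B3_B4:
  "\<exists>R\<in>set (relations p q). truth_B3_B4 (tau p' q' r') R = (s, t)"
proof -
  have "(s, t) \<in> truth_B3_B4 (tau p' q' r') ` set (relations p q)"
    using relations_truth_B3_B4[of p' q' r' p q] by (cases s; cases t) (simp_all only: insert_subset)
  then show ?thesis
    by (elim imageE) (blast intro: sym)
qed

theorem theorem1:
  shows "\<forall>A. A \<subseteq> Sigma_ax \<longrightarrow> satisfiable (A \<union> {Neg p | p. p \<in> Sigma_ax - A})"
proof (intro allI impI)
  fix A assume A: "A \<subseteq> Sigma_ax"
  let ?t = "tau (B2 \<in> A) (B5 \<in> A) (B6 \<in> A)"
  obtain R where R: "R \<in> set (relations (A3 \<in> A) (B1 \<in> A))"
    and truth: "truth_B3_B4 ?t R = (B3 \<in> A, B4 \<in> A)"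
    by (rule bexE[OF relations_B3_B4])
  have B3: "(\<forall>a\<in>set pts. \<forall>b\<in>set pts. rel R a b (?t b a a)) \<longleftrightarrow> B3 \<in> A"
    using truth unfolding truth_B3_B4_def prod.inject by (rule conjunct1)
  have B4: "(\<forall>a\<in>set pts. \<forall>b\<in>set pts. \<forall>c\<in>set pts. \<forall>x\<in>set pts.
      rel R a b c \<longrightarrow> rel R x (?t a b x) (?t a c x)) \<longleftrightarrow> B4 \<in> A"
    using truth unfolding truth_B3_B4_def prod.inject by (rule conjunct2)
  \<comment> \<open>The constants come last: the triple depends on \<open>R\<close>, and no axiom
    but B7 sees it.\<close>
  obtain a b c where pts: "a \<in> set pts" "b \<in> set pts" "c \<in> set pts"
    and B7: "(\<not> rel R a b c) \<longleftrightarrow> B7 \<in> A"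
    using relations_B7[rule_format, OF R, of "B7 \<in> A"] by (elim bexE) (rule that)
  note truths = relations_A3[rule_format, OF R] relations_B1[rule_format, OF R]
    B3 B4 B7 tau_B2[rule_format] tau_B5[rule_format] tau_B6[rule_format]
  show "satisfiable (A \<union> {Neg p | p. p \<in> Sigma_ax - A})"
  proof (rule satisfiable_if_truth_pattern[OF _ _ A])
    show "is_struct (model R ?t a b c)"
      using pts tau_closed by (auto simp: is_struct_def model_def)
    show "sat (model R ?t a b c) v p \<longleftrightarrow> p \<in> A" if "p \<in> Sigma_ax" for p v
      using that unfolding Sigma_ax_def
      by (elim insertE emptyE; simp only: sat_axioms model_def struct.simps truths)
  qed
qed

end
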